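(* Let $F$ and $m$ be positive integers such that $m\nmid F$. Then: 1. If $F=m-1$, then $\{\mathrm{g}(S)\mid S\in\mathscr{R}(F,m)\}=\{m-1\}$. 2. If $m<F<2m$, then $\{\mathrm{g}(S)\mid S\in\mathscr{R}(F,m)\}=\{m,m+1,\ldots,F-1\}$. 3. If $F>2m$, then $\{\mathrm{g}(S)\mid S\in\mathscr{R}(F,m)\}=\left\{\left\lceil\frac{F+1}{2}\right\rceil,\ldots,F-\left\lfloor\frac{F}{m}\right\rfloor\right\}$, the set of all integers $g$ with $\left\lceil\frac{F+1}{2}\right\rceil\le g\le F-\left\lfloor\frac{F}{m}\right\rfloor$.
   Context: A numerical semigroup is a submonoid $S$ of $(\mathbb{N},+)$ ($\mathbb{N}$ the nonnegative integers) with $\mathbb{N}\setminus S$ finite. Its genus $\mathrm{g}(S)$ is the cardinality of $\mathbb{N}\setminus S$, its Frobenius number $\mathrm{F}(S)$ is the largest integer not in $S$, and its multiplicity is $\mathrm{m}(S)=\min(S\setminus\{0\})$. $\mathscr{R}(F,m)$ denotes the set of numerical semigroups $S$ with $\mathrm{F}(S)=F$ and $\mathrm{m}(S)=m$. *)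

theory Defs
  imports Complex_Main
begin

definition numerical_semigroup :: "nat set \<Rightarrow> bool" where
  "numerical_semigroup S \<longleftrightarrow>
     0 \<in> S \<and> (\<forall>x\<in>S. \<forall>y\<in>S. x + y \<in> S) \<and> finite (UNIV - S)"

definition genus :: "nat set \<Rightarrow> nat" where
  "genus S = card (UNIV - S)"

text \<open>The maximum is taken over all integers, so the Frobenius number of the whole
  of the natural numbers is \<open>-1\<close>.\<close>

definition frobenius :: "nat set \<Rightarrow> int" where
  "frobenius S = (GREATEST z. z \<notin> int ` S)"

definition multiplicity_of :: "nat set \<Rightarrow> nat" where
  "multiplicity_of S = (LEAST n. n \<in> S - {0})"

definition semigroups_with :: "nat \<Rightarrow> nat \<Rightarrow> nat set set" where
  "semigroups_with F m =
     {S. numerical_semigroup S \<and> frobenius S = int F \<and> multiplicity_of S = m}"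

end

theory Submission
  imports Defs
begin

text \<open>
  All gaps of a semigroup with Frobenius number \<open>F\<close> lie in \<open>{1..F}\<close>, so every claim is a count
  inside that interval.

  Upper bounds hold because the multiples of \<open>m\<close> up to \<open>F\<close> are not gaps. The lower bound
  \<open>F + 1 \<le> 2 * g\<close> holds because \<open>x\<close> and \<open>F - x\<close> cannot both be elements, their sum being the
  gap \<open>F\<close>; in the case \<open>m < F < 2 * m\<close> the gaps \<open>1, \<dots>, m - 1, F\<close> give the better bound \<open>m \<le> g\<close>.
  For \<open>F = m - 1\<close> the gaps are exactly the numbers below \<open>m\<close> other than \<open>0\<close>.

  For \<open>F < 2 * m\<close> every value is attained by an explicit set, since the sum of two nonzero
  elements already exceeds \<open>F\<close>. For \<open>F > 2 * m\<close> the largest genus is attained by the multiples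
  of \<open>m\<close> together with everything above \<open>F\<close>, and the smaller values are reached by
  filling one gap at a time (\<open>exists_semigroup_with_one_gap_less\<close>). As long as the genus exceeds
  the lower bound, counting yields a pair \<open>x \<noteq> F - x\<close> consisting of two gaps. The
  largest member \<open>h\<close> of all such pairs can be added to the semigroup without losing closure under
  addition. Since \<open>h > F / 2 > m\<close>, the multiplicity survives, which is where \<open>F > 2 * m\<close> enters.
\<close>

section \<open>Frobenius number and multiplicity by membership\<close>

lemma frobenius_eq_iff:
  assumes "finite (UNIV - S)"
  shows "frobenius S = int F \<longleftrightarrow> F \<notin> S \<and> (\<forall>x>F. x \<in> S)"
proof -
  \<comment> \<open>The value \<open>-1\<close> is a member of the maximised set, and the relevant one if \<open>S\<close> has no gaps.\<close>
  define z where "z = Max (insert (- 1) (int ` (UNIV - S)))"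
  have fin: "finite (insert (- 1) (int ` (UNIV - S)))"
    using assms by simp
  have "z \<in> insert (- 1) (int ` (UNIV - S))"
    unfolding z_def using fin by (intro Max_in) auto
  then have z_out: "z \<notin> int ` S"
    by auto
  have z_ge: "y \<le> z" if "y \<notin> int ` S" for y
  proof (cases "y < 0")
    case True
    have "- 1 \<le> z"
      unfolding z_def using fin by (intro Max_ge) auto
    with True show ?thesis by linarith
  next
    case False
    then have y: "y = int (nat y)" by simp
    then have "nat y \<notin> S" using that by (metis image_eqI)
    then have "y \<in> int ` (UNIV - S)" using y by blast
    then show ?thesis
      unfolding z_def using fin by (intro Max_ge) auto
  qed
  have frob: "frobenius S = z"
    unfolding frobenius_def using z_out z_ge by (rule Greatest_equality)
  show ?thesis
  proof
    assume "frobenius S = int F"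
    then have z: "z = int F" using frob by simp
    have "x \<in> S" if "x > F" for x
    proof (rule ccontr)
      assume "x \<notin> S"
      then have "int x \<notin> int ` S" by auto
      from z_ge[OF this] z that show False by simp
    qed
    with z_out z show "F \<notin> S \<and> (\<forall>x>F. x \<in> S)" by auto
  next
    assume F: "F \<notin> S \<and> (\<forall>x>F. x \<in> S)"
    then have "int F \<le> z" by (intro z_ge) auto
    moreover have "z \<le> int F"
    proof (rule ccontr)
      assume "\<not> z \<le> int F"
      then have "nat z > F" "z = int (nat z)" by auto
      then show False using F z_out by (metis image_eqI)
    qed
    ultimately show "frobenius S = int F" using frob by simp
  qed
qed

lemma multiplicity_of_eq_iff:
  assumes "S - {0} \<noteq> {}"
  shows "multiplicity_of S = m \<longleftrightarrow> m > 0 \<and> m \<in> S \<and> (\<forall>x. 0 < x \<and> x < m \<longrightarrow> x \<notin> S)"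
proof
  assume m: "multiplicity_of S = m"
  have "m \<in> S - {0}"
    using assms LeastI[of "\<lambda>n. n \<in> S - {0}"] m unfolding multiplicity_of_def by blast
  moreover have "x \<notin> S" if "0 < x" "x < m" for x
    using that m not_less_Least[of x "\<lambda>n. n \<in> S - {0}"] unfolding multiplicity_of_def by auto
  ultimately show "m > 0 \<and> m \<in> S \<and> (\<forall>x. 0 < x \<and> x < m \<longrightarrow> x \<notin> S)" by auto
next
  assume "m > 0 \<and> m \<in> S \<and> (\<forall>x. 0 < x \<and> x < m \<longrightarrow> x \<notin> S)"
  then show "multiplicity_of S = m"
    unfolding multiplicity_of_def by (intro Least_equality) (auto simp: not_less[symmetric])
qed

lemma semigroups_with_iff:
  "S \<in> semigroups_with F m \<longleftrightarrow>
     0 \<in> S \<and> (\<forall>x\<in>S. \<forall>y\<in>S. x + y \<in> S) \<and> F \<notin> S \<and> (\<forall>x>F. x \<in> S) \<and>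
     m > 0 \<and> m \<in> S \<and> (\<forall>x. 0 < x \<and> x < m \<longrightarrow> x \<notin> S)"
  (is "_ \<longleftrightarrow> ?R")
proof -
  have fin: "finite (UNIV - S)" if "\<forall>x>F. x \<in> S"
    by (rule finite_subset[of _ "{..F}"]) (use that in \<open>auto simp: not_less[symmetric]\<close>)
  have nonempty: "S - {0} \<noteq> {}" if "\<forall>x>F. x \<in> S"
    using that[rule_format, of "Suc F"] by auto
  show ?thesis
  proof
    assume "S \<in> semigroups_with F m"
    then have S: "0 \<in> S" "\<forall>x\<in>S. \<forall>y\<in>S. x + y \<in> S" "finite (UNIV - S)"
        "frobenius S = int F" "multiplicity_of S = m"
      by (auto simp: semigroups_with_def numerical_semigroup_def)
    have F: "F \<notin> S \<and> (\<forall>x>F. x \<in> S)" using S(4) frobenius_eq_iff[OF S(3)] by simp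
    then show ?R using S multiplicity_of_eq_iff[OF nonempty] by auto
  next
    assume R: ?R
    then have "finite (UNIV - S)" "S - {0} \<noteq> {}" using fin nonempty by auto
    then show "S \<in> semigroups_with F m"
      using R frobenius_eq_iff multiplicity_of_eq_iff
      by (simp add: semigroups_with_def numerical_semigroup_def)
  qed
qed

section \<open>Bounds on the genus\<close>

lemma gaps_eq:
  assumes "S \<in> semigroups_with F m"
  shows "UNIV - S = {1..F} - S"
proof -
  have "0 \<in> S" "\<forall>x>F. x \<in> S" using assms by (auto simp: semigroups_with_iff)
  then have "x \<in> {1..F}" if "x \<notin> S" for x
    using that by (cases "x = 0") (auto simp: not_less[symmetric])
  then show ?thesis by auto
qed

lemma finite_gaps:
  assumes "S \<in> semigroups_with F m"
  shows "finite (UNIV - S)"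
  unfolding gaps_eq[OF assms] by simp

lemma card_multiples:
  fixes F m :: nat
  assumes "m > 0"
  shows "card ((\<lambda>k. k * m) ` {1..F div m}) = F div m"
    and "(\<lambda>k. k * m) ` {1..F div m} = {x \<in> {1..F}. m dvd x}"
proof -
  have "inj_on (\<lambda>k. k * m) {1..F div m}" using assms by (auto intro: inj_onI)
  then show "card ((\<lambda>k. k * m) ` {1..F div m}) = F div m" by (simp add: card_image)
  show "(\<lambda>k. k * m) ` {1..F div m} = {x \<in> {1..F}. m dvd x}"
    using assms by (auto simp: less_eq_div_iff_mult_less_eq image_iff mult.commute elim!: dvdE)
qed

lemma card_nonmultiples:
  fixes F m :: nat
  assumes "m > 0"
  shows "card {x \<in> {1..F}. \<not> m dvd x} = F - F div m"
proof -
  have "{x \<in> {1..F}. \<not> m dvd x} = {1..F} - {x \<in> {1..F}. m dvd x}" by auto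
  also have "card \<dots> = F - F div m"
    using card_multiples[OF assms, of F] by (subst card_Diff_subset) auto
  finally show ?thesis .
qed

lemma multiple_mem:
  assumes S: "S \<in> semigroups_with F m"
  shows "k * m \<in> S"
  by (induction k) (use S in \<open>auto simp: semigroups_with_iff\<close>)

lemma genus_le:
  assumes S: "S \<in> semigroups_with F m"
  shows "genus S \<le> F - F div m"
proof -
  have "UNIV - S \<subseteq> {x \<in> {1..F}. \<not> m dvd x}"
    unfolding gaps_eq[OF S] using multiple_mem[OF S] by (auto elim!: dvdE simp: mult.commute)
  then have "genus S \<le> card {x \<in> {1..F}. \<not> m dvd x}"
    unfolding genus_def by (intro card_mono) auto
  then show ?thesis
    using card_nonmultiples[of m F] S by (auto simp: semigroups_with_iff)
qed

lemma card_elements_up_to: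
  assumes S: "S \<in> semigroups_with F m"
  shows "card (S \<inter> {..F}) + genus S = Suc F"
proof -
  have "(S \<inter> {..F}) \<union> (UNIV - S) = {..F}" using gaps_eq[OF S] by auto
  then have "card (S \<inter> {..F}) + card (UNIV - S) = card {..F}"
    using finite_gaps[OF S] by (subst card_Un_disjoint[symmetric]) auto
  then show ?thesis by (simp add: genus_def)
qed

text \<open>The reflection \<open>x \<mapsto> F - x\<close> sends elements to gaps, so there are at least as many gaps as
  elements among the \<open>F + 1\<close> numbers up to \<open>F\<close>.\<close>

lemma genus_ge_half:
  assumes S: "S \<in> semigroups_with F m"
  shows "Suc F \<le> 2 * genus S"
proof -
  have "F - x \<notin> S" if "x \<in> S" "x \<le> F" for x
  proof
    assume "F - x \<in> S"
    then have "x + (F - x) \<in> S" using that S unfolding semigroups_with_iff by blast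
    then show False using that S by (simp add: semigroups_with_iff)
  qed
  then have "(\<lambda>x. F - x) ` (S \<inter> {..F}) \<subseteq> UNIV - S" by auto
  moreover have "inj_on (\<lambda>x. F - x) (S \<inter> {..F})" by (auto intro!: inj_onI)
  ultimately have "card (S \<inter> {..F}) \<le> genus S"
    unfolding genus_def using finite_gaps[OF S] by (metis card_inj_on_le)
  then show ?thesis using card_elements_up_to[OF S] by linarith
qed

lemma genus_ge_multiplicity:
  assumes S: "S \<in> semigroups_with F m" and "m < F"
  shows "m \<le> genus S"
proof -
  have "insert F {1..<m} \<subseteq> UNIV - S" using S by (auto simp: semigroups_with_iff)
  then have "card (insert F {1..<m}) \<le> genus S"
    unfolding genus_def using finite_gaps[OF S] by (rule card_mono[rotated])
  then show ?thesis using \<open>m < F\<close> by simp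
qed

section \<open>Semigroups with prescribed genus\<close>

lemma genus_of_ordinary_semigroup:
  assumes "S \<in> semigroups_with (m - 1) m"
  shows "genus S = m - 1"
proof -
  have "UNIV - S = {1..m - 1}"
    unfolding gaps_eq[OF assms] using assms by (auto simp: semigroups_with_iff)
  then show ?thesis by (simp add: genus_def)
qed

lemma ordinary_semigroup:
  assumes "m > 1"
  shows "insert 0 {m..} \<in> semigroups_with (m - 1) m"
  using assms by (auto simp: semigroups_with_iff)

lemma exists_semigroup_below_twice_multiplicity:
  assumes "m > 0" "F < 2 * m" "m \<le> g" "g < F"
  shows "\<exists>S \<in> semigroups_with F m. genus S = g"
proof -
  define S where "S = {0, m} \<union> {g<..<F} \<union> {F<..}"
  have big: "x = 0 \<or> m \<le> x" if "x \<in> S" for x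
    using that assms by (auto simp: S_def)
  have closed: "x + y \<in> S" if "x \<in> S" "y \<in> S" for x y
  proof (cases "x = 0 \<or> y = 0")
    case True
    with that show ?thesis by auto
  next
    case False
    then have "F < x + y" using big[OF that(1)] big[OF that(2)] assms by linarith
    then show ?thesis by (auto simp: S_def)
  qed
  have S: "S \<in> semigroups_with F m"
    unfolding semigroups_with_iff using closed assms by (auto simp: S_def)
  have "UNIV - S = insert F ({1..g} - {m})"
    using assms by (auto simp: S_def)
  then have "genus S = g" using assms by (simp add: genus_def)
  with S show ?thesis by blast
qed

lemma exists_semigroup_with_maximal_genus:
  assumes "m > 0" "m < F" "\<not> m dvd F"
  shows "\<exists>S \<in> semigroups_with F m. genus S = F - F div m"
proof -
  define S where "S = {x. m dvd x} \<union> {F<..}"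
  have S: "S \<in> semigroups_with F m"
    unfolding semigroups_with_iff using assms by (auto simp: S_def dest: dvd_imp_le)
  have "UNIV - S = {x \<in> {1..F}. \<not> m dvd x}"
    unfolding gaps_eq[OF S] by (auto simp: S_def)
  then have "genus S = F - F div m"
    using card_nonmultiples[OF assms(1)] by (simp add: genus_def)
  with S show ?thesis by blast
qed

text \<open>If no two distinct gaps were exchanged by \<open>x \<mapsto> F - x\<close>, all gaps but possibly \<open>F / 2\<close>
  would be reflected to elements, leaving room for too few gaps.\<close>

lemma exists_reflected_pair_of_gaps:
  assumes S: "S \<in> semigroups_with F m" and g: "F + 2 < 2 * genus S"
  shows "\<exists>x \<le> F. x \<notin> S \<and> F - x \<notin> S \<and> 2 * x \<noteq> F"
proof (rule ccontr)
  assume none: "\<not> ?thesis"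
  let ?G = "UNIV - S - {F div 2}"
  have G: "x \<le> F" if "x \<in> ?G" for x using that gaps_eq[OF S] by auto
  have "(\<lambda>x. F - x) ` ?G \<subseteq> S \<inter> {..F}"
  proof
    fix y assume "y \<in> (\<lambda>x. F - x) ` ?G"
    then obtain x where x: "x \<in> ?G" "y = F - x" by blast
    then have "2 * x \<noteq> F" by auto
    then show "y \<in> S \<inter> {..F}" using none x G[OF x(1)] by auto
  qed
  moreover have "inj_on (\<lambda>x. F - x) ?G" using G by (intro inj_onI) (metis diff_diff_cancel)
  ultimately have "card ?G \<le> card (S \<inter> {..F})" by (metis card_inj_on_le finite_Int finite_atMost)
  moreover have "genus S - 1 \<le> card ?G"
    unfolding genus_def by (simp add: card_Diff_singleton_if)
  ultimately show False using card_elements_up_to[OF S] g by linarith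
qed

text \<open>The gap to fill is the largest one that belongs to a reflected pair of distinct gaps. Its
  maximality is what keeps the set closed: a sum of this gap and a nonzero element that was again
  a gap would have an element as its reflection, and adding the summand back would make the
  reflection of the chosen gap an element too.\<close>

lemma exists_semigroup_with_one_gap_less:
  assumes S: "S \<in> semigroups_with F m" and mF: "2 * m \<le> F" and g: "F + 2 < 2 * genus S"
  shows "\<exists>T \<in> semigroups_with F m. Suc (genus T) = genus S"
proof -
  have zero: "0 \<in> S" and closed: "\<And>x y. x \<in> S \<Longrightarrow> y \<in> S \<Longrightarrow> x + y \<in> S"
    and F: "F \<notin> S" and above: "\<And>x. F < x \<Longrightarrow> x \<in> S"
    and m: "m > 0" "m \<in> S" "\<And>x. 0 < x \<Longrightarrow> x < m \<Longrightarrow> x \<notin> S"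
    using S unfolding semigroups_with_iff by auto
  define P where "P = {x. x \<le> F \<and> x \<notin> S \<and> F - x \<notin> S \<and> 2 * x \<noteq> F}"
  define h where "h = Max P"
  have fin: "finite P" by (rule finite_subset[of _ "{..F}"]) (auto simp: P_def)
  obtain x where x: "x \<in> P"
    using exists_reflected_pair_of_gaps[OF S g] by (auto simp: P_def)
  have max: "y \<le> h" if "y \<in> P" for y unfolding h_def using fin that by (rule Max_ge)
  have "h \<in> P" unfolding h_def using fin x by (intro Max_in) auto
  then have h: "h \<le> F" "h \<notin> S" "F - h \<notin> S" "2 * h \<noteq> F" by (auto simp: P_def)
  \<comment> \<open>The reflection of \<open>h\<close> competes for the maximum.\<close>
  have "F - h \<in> P" using h by (auto simp: P_def)
  then have half: "F < 2 * h" using max[of "F - h"] h by linarith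
  have "h \<noteq> F" using h(3) zero by auto
  have sum_h: "h + s \<in> S" if s: "s \<in> S" "s \<noteq> 0" for s
  proof (rule ccontr)
    assume out: "h + s \<notin> S"
    then have le: "h + s \<le> F" using above by (meson not_le)
    have "h + s \<notin> P" using max[of "h + s"] s by auto
    then have "F - (h + s) \<in> S" using out le half by (auto simp: P_def)
    from closed[OF this s(1)] have "F - h \<in> S" using le by simp
    with h(3) show False ..
  qed
  have closed': "a + b \<in> insert h S" if "a \<in> insert h S" "b \<in> insert h S" for a b
  proof -
    have "h + h \<in> S" using above half by simp
    moreover have "h + s \<in> insert h S" if "s \<in> S" for s
      using sum_h[OF that] by (cases "s = 0") auto
    ultimately show ?thesis using that closed by (metis add.commute insert_iff)
  qed
  have T: "insert h S \<in> semigroups_with F m"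
    unfolding semigroups_with_iff
    using closed' zero F above m \<open>h \<noteq> F\<close> half mF by auto
  have "UNIV - insert h S = (UNIV - S) - {h}" by auto
  then have "Suc (genus (insert h S)) = genus S"
    unfolding genus_def using h(2) finite_gaps[OF S] by (simp only: card_Suc_Diff1 UNIV_I Diff_iff simp_thms)
  with T show ?thesis by blast
qed

lemma exists_semigroup_above_twice_multiplicity:
  assumes "m > 0" "2 * m \<le> F" "\<not> m dvd F" "(F + 2) div 2 \<le> g" "g \<le> F - F div m"
  shows "\<exists>S \<in> semigroups_with F m. genus S = g"
  using assms(5)
proof (induction rule: inc_induct)
  case base
  show ?case using assms by (intro exists_semigroup_with_maximal_genus) auto
next
  case (step n)
  then obtain S where S: "S \<in> semigroups_with F m" "genus S = Suc n" by blast
  have "F + 2 < 2 * genus S" using S(2) step.hyps assms(4) by linarith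
  then show ?case using exists_semigroup_with_one_gap_less[OF S(1) assms(2)] S(2) by auto
qed

section \<open>The sets of genera\<close>

lemma int_genus_set_eq:
  assumes "\<And>S. S \<in> semigroups_with F m \<Longrightarrow> a \<le> genus S \<and> genus S \<le> b"
    and "\<And>g. a \<le> g \<Longrightarrow> g \<le> b \<Longrightarrow> \<exists>S \<in> semigroups_with F m. genus S = g"
  shows "{int (genus S) | S. S \<in> semigroups_with F m} = {int a .. int b}"
proof -
  have "z \<in> {int (genus S) | S. S \<in> semigroups_with F m}" if "int a \<le> z" "z \<le> int b" for z
  proof -
    have "a \<le> nat z" "nat z \<le> b" using that by linarith+
    from assms(2)[OF this] obtain S where "S \<in> semigroups_with F m" "genus S = nat z"
      by blast
    moreover from this have "z = int (genus S)" using that by simp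
    ultimately show ?thesis by blast
  qed
  then show ?thesis using assms(1) by fastforce
qed

theorem proposition4p8:
  fixes F m :: nat
  assumes "F > 0" and "m > 0" and "\<not> m dvd F"
  shows "(F = m - 1 \<longrightarrow>
            {int (genus S) | S. S \<in> semigroups_with F m} = {int m - 1})
       \<and> (m < F \<and> F < 2 * m \<longrightarrow>
            {int (genus S) | S. S \<in> semigroups_with F m} = {int m .. int F - 1})
       \<and> (F > 2 * m \<longrightarrow>
            {int (genus S) | S. S \<in> semigroups_with F m}
              = {\<lceil>(real F + 1) / 2\<rceil> .. int F - \<lfloor>real F / real m\<rfloor>})"
proof (intro conjI impI)
  assume F: "F = m - 1"
  have "{int (genus S) | S. S \<in> semigroups_with F m} = {int (m - 1) .. int (m - 1)}"
  proof (rule int_genus_set_eq)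
    show "m - 1 \<le> genus S \<and> genus S \<le> m - 1" if "S \<in> semigroups_with F m" for S
      using genus_of_ordinary_semigroup that F by simp
    show "\<exists>S \<in> semigroups_with F m. genus S = g" if "m - 1 \<le> g" "g \<le> m - 1" for g
      using ordinary_semigroup[of m] genus_of_ordinary_semigroup that F assms(1)
      by (metis le_antisym zero_less_diff)
  qed
  then show "{int (genus S) | S. S \<in> semigroups_with F m} = {int m - 1}"
    using assms(2) by (simp add: of_nat_diff)
next
  assume F: "m < F \<and> F < 2 * m"
  have "F div m = 1" using F by (intro div_nat_eqI) auto
  have "{int (genus S) | S. S \<in> semigroups_with F m} = {int m .. int (F - 1)}"
  proof (rule int_genus_set_eq)
    show "m \<le> genus S \<and> genus S \<le> F - 1" if "S \<in> semigroups_with F m" for S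
      using genus_ge_multiplicity[OF that] genus_le[OF that] F \<open>F div m = 1\<close> by simp
    show "\<exists>S \<in> semigroups_with F m. genus S = g" if "m \<le> g" "g \<le> F - 1" for g
      using exists_semigroup_below_twice_multiplicity[of m F g] that F assms by auto
  qed
  then show "{int (genus S) | S. S \<in> semigroups_with F m} = {int m .. int F - 1}"
    using assms(1) by (simp add: of_nat_diff)
next
  assume F: "F > 2 * m"
  have "{int (genus S) | S. S \<in> semigroups_with F m}
          = {int ((F + 2) div 2) .. int (F - F div m)}"
  proof (rule int_genus_set_eq)
    show "(F + 2) div 2 \<le> genus S \<and> genus S \<le> F - F div m"
      if "S \<in> semigroups_with F m" for S
      using genus_ge_half[OF that] genus_le[OF that] by linarith
    show "\<exists>S \<in> semigroups_with F m. genus S = g"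
      if "(F + 2) div 2 \<le> g" "g \<le> F - F div m" for g
      using exists_semigroup_above_twice_multiplicity that F assms by simp
  qed
  moreover have "int ((F + 2) div 2) = \<lceil>(real F + 1) / 2\<rceil>"
  proof (rule ceiling_unique[symmetric])
    have "real F < 2 * real ((F + 2) div 2)" "2 * real ((F + 2) div 2) \<le> real F + 2"
      by linarith+
    then show "(real F + 1) / 2 \<le> real_of_int (int ((F + 2) div 2))"
      and "real_of_int (int ((F + 2) div 2)) - 1 < (real F + 1) / 2"
      by simp_all
  qed
  moreover have "int (F - F div m) = int F - \<lfloor>real F / real m\<rfloor>"
    by (simp add: floor_divide_of_nat_eq of_nat_diff)
  ultimately show "{int (genus S) | S. S \<in> semigroups_with F m}
      = {\<lceil>(real F + 1) / 2\<rceil> .. int F - \<lfloor>real F / real m\<rfloor>}"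
    by simp
qed

end
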